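(* Let $m\ge 2$ be an integer and let $\mathbf{k}=(k_0,k_1,k_2,\ldots)$ be a sequence of positive integers. For an integer $n\ge 1$, suppose that $n$ is divisible by $m$, with base $m$ representation given by $$n=d_sm^s+\cdots+d_tm^t,\qquad 1\le s\le t,$$ where $1\le d_s\le m-1$ and $0\le d_{s+1},\ldots,d_t\le m-1$. If $m$ is relatively prime to $(k_0-1)!$ and to $k_j!$ for all $j\ge 1$, then for every integer $d_0$ with $0\le d_0\le m-1$ we have $$c^{(\mathbf{k})}_m(n-d_0)\equiv\binom{k_0-1-d_0}{k_0-1}\left(\varepsilon_s+(-1)^{s-1}\left\{\binom{k_s+d_s-1}{k_s}-1\right\}\sum_{i=s}^{t}\ \prod_{j=s+1}^{i}\left\{\binom{k_j+d_j}{k_j}-1\right\}\right)\pmod m,$$ where $\varepsilon_s=0$ if $s$ is even, $\varepsilon_s=1$ if $s$ is odd, and $c^{(\mathbf{k})}_m(N)$ is the number of $\mathbf{k}$-coloured $m$-ary partitions of $N$ without gaps.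
   Context: An $m$-ary partition of an integer $N$ is an integer partition of $N$ in which each part is a nonnegative integer power of the fixed integer $m\ge 2$. Given a sequence $\mathbf{k}=(k_0,k_1,\ldots)$ of positive integers, an $m$-ary partition is $\mathbf{k}$-coloured when there are $k_j$ colours for the part $m^j$, for each $j\ge 0$; that is, there are $k_j$ different kinds of parts of the same size $m^j$ (so a $\mathbf{k}$-coloured $m$-ary partition of $N$ is a finite multiset of pairs $(j,c)$ with $j\ge 0$, $1\le c\le k_j$, whose sizes $m^j$ sum to $N$). It is without gaps if, for every nonnegative integer $j$, some part $m^j$ of any colour occurs whenever some part $m^{j+1}$ of any colour (not necessarily the same colour) occurs. For $N\ge 1$, $c^{(\mathbf{k})}_m(N)$ denotes the number of $\mathbf{k}$-coloured $m$-ary partitions of $N$ without gaps; equivalently $1+\sum_{N\ge 1} c^{(\mathbf{k})}_m(N)q^N=1+\sum_{i\ge 0}\prod_{j=0}^{i}\left((1-q^{m^j})^{-k_j}-1\right)$. For an integer $x$ (possibly negative) and an integer $r\ge 0$, $\binom{x}{r}=\frac{x(x-1)\cdots(x-r+1)}{r!}$ (falling factorial divided by $r!$). Empty products equal $1$. *)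

theory Defs
  imports Complex_Main "HOL-Library.Multiset" "HOL-Number_Theory.Cong"
begin

text \<open>
  A coloured part is a pair \<open>(j, c)\<close>: a part of size \<open>m ^ j\<close> having the colour \<open>c\<close>, where the
  colours available for \<open>m ^ j\<close> are \<open>1, \<dots>, k j\<close>.
\<close>

definition coloured_mary_partition ::
    "nat \<Rightarrow> (nat \<Rightarrow> nat) \<Rightarrow> nat \<Rightarrow> (nat \<times> nat) multiset \<Rightarrow> bool" where
  "coloured_mary_partition m k N P \<longleftrightarrow>
     (\<forall>(j, c) \<in> set_mset P. 1 \<le> c \<and> c \<le> k j) \<and> (\<Sum>(j, c) \<in># P. m ^ j) = N"

definition without_gaps :: "(nat \<times> nat) multiset \<Rightarrow> bool" where
  "without_gaps P \<longleftrightarrow> (\<forall>j. (\<exists>c. (Suc j, c) \<in># P) \<longrightarrow> (\<exists>c. (j, c) \<in># P))"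

definition num_gapfree :: "nat \<Rightarrow> (nat \<Rightarrow> nat) \<Rightarrow> nat \<Rightarrow> nat" where
  "num_gapfree m k N = card {P. coloured_mary_partition m k N P \<and> without_gaps P}"

text \<open>
  The cardinality above is that of a finite set as soon as \<open>m \<ge> 2\<close>.
\<close>

lemma finite_coloured_mary_partitions:
  assumes "m \<ge> 2"
  shows "finite {P. coloured_mary_partition m k N P}"
proof -
  let ?A = "SIGMA j:{..N}. {1..k j}"
  have "{P. coloured_mary_partition m k N P} \<subseteq> mset ` {xs. set xs \<subseteq> ?A \<and> length xs \<le> N}"
  proof
    fix P assume "P \<in> {P. coloured_mary_partition m k N P}"
    then have col: "\<And>j c. (j, c) \<in># P \<Longrightarrow> 1 \<le> c \<and> c \<le> k j"
      and sum: "(\<Sum>(j, c) \<in># P. m ^ j) = N"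
      by (auto simp: coloured_mary_partition_def)
    have "size P = (\<Sum>x \<in># P. 1)"
      by simp
    also have "\<dots> \<le> (\<Sum>(j, c) \<in># P. m ^ j)"
      using assms by (intro sum_mset_mono) (auto simp: Suc_le_eq)
    finally have size: "size P \<le> N"
      using sum by simp
    have "j \<le> N" if "(j, c) \<in># P" for j c
    proof -
      have "m ^ j \<le> (\<Sum>(j, c) \<in># P. m ^ j)"
        using that by (auto dest!: multi_member_split)
      moreover have "j < m ^ j"
        using assms by (intro power_gt_expt) simp
      ultimately show ?thesis
        using sum by linarith
    qed
    with col have "set_mset P \<subseteq> ?A"
      by auto
    moreover obtain xs where "P = mset xs"
      by (metis ex_mset)
    ultimately show "P \<in> mset ` {xs. set xs \<subseteq> ?A \<and> length xs \<le> N}"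
      using size by auto
  qed
  moreover have "finite {xs. set xs \<subseteq> ?A \<and> length xs \<le> N}"
    by (intro finite_lists_length_le) auto
  ultimately show ?thesis
    by (meson finite_imageI finite_subset)
qed

text \<open>
  The next constant is the library's \<open>gchoose\<close> at type \<open>int\<close>, with its definition written out,
  because the parser restricts \<open>gchoose\<close> to fields of characteristic 0 in \<open>Complex_Main\<close> and
  would silently coerce the arguments to the reals. The division is exact.
\<close>

definition zbinomial :: "int \<Rightarrow> nat \<Rightarrow> int"  (infix \<open>zchoose\<close> 64) where
  "x zchoose r = (\<Prod>i = 0..<r. x - int i) div fact r"

lemma zbinomial_mult_fact: "(x zchoose r) * fact r = (\<Prod>i = 0..<r. x - int i)"
  unfolding zbinomial_def gbinomial_prod_rev[where ?'a = int, simplified, symmetric]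
  by (rule gbinomial_int_mult_fact')

lemma of_int_zbinomial: "of_int (x zchoose r) = (of_int x :: 'a :: field_char_0) gchoose r"
proof -
  have "of_int ((x zchoose r) * fact r) = (\<Prod>i = 0..<r. (of_int x :: 'a) - of_nat i)"
    by (simp only: zbinomial_mult_fact of_int_prod of_int_diff of_int_of_nat_eq)
  then show ?thesis
    by (simp add: gbinomial_prod_rev field_simps)
qed

end

theory Submission
  imports Defs
begin

text \<open>
  Splitting off the parts of size one expresses \<open>c\<^sub>k(N)\<close> through the values \<open>c\<^sub>k\<^sub>'(M)\<close> with \<open>m M < N\<close>,
  where \<open>k'\<close> is the shifted sequence of colours. A binomial coefficient with lower entry \<open>r\<close> is
  periodic modulo \<open>m\<close> in its upper entry as soon as \<open>m\<close> is coprime to \<open>r!\<close>. Hence the coefficients of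
  this recurrence are constant modulo \<open>m\<close>, so that \<open>c\<^sub>k(n - d\<^sub>0)\<close> is a constant times a partial sum of
  \<open>c\<^sub>k\<^sub>'\<close>, and the partial sums \<open>T\<^sub>k(n) = c\<^sub>k(0) + \<dots> + c\<^sub>k(n)\<close> themselves satisfy
  \<open>T\<^sub>k(n) \<equiv> 1 + (binom(k\<^sub>0 + n, k\<^sub>0) - 1) T\<^sub>k\<^sub>'(n div m)\<close>: the digits of \<open>n\<close> are processed one by one.
\<close>

section \<open>Binomial coefficients modulo \<open>m\<close>\<close>

lemma zchoose_of_nat: "int n zchoose r = int (n choose r)"
proof -
  have "(of_int (int n zchoose r) :: real) = of_int (int (n choose r))"
    by (simp add: of_int_zbinomial binomial_gbinomial)
  then show ?thesis
    by (simp only: of_int_eq_iff)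
qed

text \<open>Multiplied by \<open>fact r\<close>, the binomial becomes an integer polynomial in its
  upper entry, which respects congruences; coprimality allows \<open>fact r\<close> to be cancelled
  modulo \<open>m\<close>.\<close>

lemma zchoose_cong:
  assumes "coprime m (fact r)" and "[x = y] (mod int m)"
  shows "[x zchoose r = y zchoose r] (mod int m)"
proof -
  have "[(x zchoose r) * fact r = (y zchoose r) * fact r] (mod int m)"
    unfolding zbinomial_mult_fact using assms(2) by (intro cong_prod cong_diff) auto
  moreover have "coprime (fact r) (int m)"
    using assms(1) by (metis coprime_commute coprime_int_iff of_nat_fact)
  ultimately show ?thesis
    by (simp add: cong_mult_rcancel)
qed

text \<open>The hockey-stick identity without its term \<open>a = 0\<close>, whose value 1 is
  subtracted on the right.\<close>

lemma sum_choose_diagonal: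
  assumes "r \<ge> 1"
  shows "(\<Sum>a = 1..n. int ((a + r - 1) choose (r - 1))) = int ((n + r) choose r) - 1"
proof (induction n)
  case (Suc n)
  obtain q where "r = Suc q"
    using assms by (cases r) auto
  with Suc show ?case
    by simp
qed simp

section \<open>Removing the parts of size one\<close>

text \<open>\<open>A\<close> holds the colours of the unit parts. Exponents in \<open>Q\<close> are
  stored lowered by one, so that \<open>Q\<close> is again a partition, coloured by the shifted
  sequence.\<close>

definition join_units :: "nat multiset \<Rightarrow> (nat \<times> nat) multiset \<Rightarrow> (nat \<times> nat) multiset" where
  "join_units A Q = image_mset (Pair 0) A + image_mset (map_prod Suc id) Q"

lemma join_units_exhaust: obtains A Q where "P = join_units A Q"
proof -
  have "\<exists>A Q. P = join_units A Q"
  proof (induction P)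
    case empty
    have "{#} = join_units {#} {#}"
      by (simp add: join_units_def)
    then show ?case
      by blast
  next
    case (add x P)
    then obtain A Q where P: "P = join_units A Q"
      by blast
    obtain j c where x: "x = (j, c)"
      by (cases x)
    show ?case
    proof (cases j)
      case 0
      then have "add_mset x P = join_units (add_mset c A) Q"
        using P x by (simp add: join_units_def)
      then show ?thesis
        by blast
    next
      case (Suc i)
      then have "add_mset x P = join_units A (add_mset (i, c) Q)"
        using P x by (simp add: join_units_def)
      then show ?thesis
        by blast
    qed
  qed
  then show ?thesis
    using that by blast
qed

lemma join_units_inject [simp]: "join_units A Q = join_units B R \<longleftrightarrow> A = B \<and> Q = R"
proof
  assume eq: "join_units A Q = join_units B R"
  \<comment> \<open>Filtering by whether the exponent is zero recovers both summands, each the image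
    under an injective map.\<close>
  have units: "filter_mset (\<lambda>p. fst p = 0) (join_units C S) = image_mset (Pair 0) C"
    and rest: "filter_mset (\<lambda>p. fst p \<noteq> 0) (join_units C S) = image_mset (map_prod Suc id) S" for C S
    by (simp_all add: join_units_def filter_mset_image_mset comp_def)
  have "image_mset (Pair (0::nat)) A = image_mset (Pair 0) B"
    using units eq by metis
  then have "A = B"
    by (rule injD[OF multiset.inj_map, rotated]) (simp add: inj_def)
  have "image_mset (map_prod Suc id) Q = image_mset (map_prod Suc id) R"
    using rest eq by metis
  then have "Q = R"
    by (rule injD[OF multiset.inj_map, rotated]) (auto simp: inj_def)
  with \<open>A = B\<close> show "A = B \<and> Q = R"
    by simp
qed simp

lemma coloured_join_units_iff:
  "coloured_mary_partition m k N (join_units A Q) \<longleftrightarrow>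
     set_mset A \<subseteq> {1..k 0} \<and>
     (\<exists>M. coloured_mary_partition m (\<lambda>j. k (Suc j)) M Q \<and> N = size A + m * M)"
proof -
  have "(\<Sum>(j, c) \<in># join_units A Q. m ^ j) = size A + m * (\<Sum>(j, c) \<in># Q. m ^ j)"
    by (simp add: join_units_def image_mset.compositionality comp_def case_prod_unfold
        sum_mset_distrib_left)
  moreover have "(\<forall>(j, c) \<in> set_mset (join_units A Q). 1 \<le> c \<and> c \<le> k j) \<longleftrightarrow>
      set_mset A \<subseteq> {1..k 0} \<and> (\<forall>(j, c) \<in> set_mset Q. 1 \<le> c \<and> c \<le> k (Suc j))"
    by (auto simp: join_units_def ball_Un)
  ultimately show ?thesis
    unfolding coloured_mary_partition_def by auto
qed

lemma without_gaps_imp_unit: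
  assumes "without_gaps Q" and "Q \<noteq> {#}"
  shows "\<exists>c. (0, c) \<in># Q"
proof -
  have "\<exists>c. (0, c) \<in># Q" if "(j, c) \<in># Q" for j c
    using that
  proof (induction j arbitrary: c)
    case (Suc j)
    then show ?case
      using assms(1) unfolding without_gaps_def by blast
  qed blast
  with assms(2) show ?thesis
    by (metis multiset_nonemptyE surj_pair)
qed

text \<open>A nonempty gap-free \<open>Q\<close> contains the exponent 0, so the passage from
  exponent 0 to 1 is the only place where \<open>A\<close> and \<open>Q\<close> interact.\<close>

lemma without_gaps_join_units_iff:
  "without_gaps (join_units A Q) \<longleftrightarrow> (Q \<noteq> {#} \<longrightarrow> A \<noteq> {#}) \<and> without_gaps Q"
proof -
  have mem0: "(\<exists>c. (0, c) \<in># join_units A Q) \<longleftrightarrow> A \<noteq> {#}"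
    by (cases A) (auto simp: join_units_def)
  have memS: "(Suc j, c) \<in># join_units A Q \<longleftrightarrow> (j, c) \<in># Q" for j c
    by (force simp: join_units_def)
  have all_nat: "(\<forall>j. R j) \<longleftrightarrow> R 0 \<and> (\<forall>j. R (Suc j))" for R
    by (metis not0_implies_Suc)
  have "without_gaps (join_units A Q) \<longleftrightarrow> ((\<exists>c. (0, c) \<in># Q) \<longrightarrow> A \<noteq> {#}) \<and> without_gaps Q"
    unfolding without_gaps_def by (subst all_nat) (simp add: mem0 memS)
  then show ?thesis
    using without_gaps_imp_unit[of Q] by auto
qed

section \<open>The recurrence for the number of gap-free partitions\<close>

lemma num_gapfree_0 [simp]:
  assumes "m \<ge> 1"
  shows "num_gapfree m k 0 = 1"
proof -
  have "P = {#}" if "coloured_mary_partition m k 0 P" for P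
    using that assms by (cases P) (auto simp: coloured_mary_partition_def)
  then have "{P. coloured_mary_partition m k 0 P \<and> without_gaps P} = {{#}}"
    by (auto simp: coloured_mary_partition_def without_gaps_def)
  then show ?thesis
    by (simp add: num_gapfree_def)
qed

text \<open>Group the partitions by the weight \<open>M\<close> of what remains after the units are
  removed. The \<open>N - m * M\<close> units form an arbitrary multiset of \<open>k 0\<close>
  colours, counted by stars and bars; there is at least one unit, hence the strict bound on
  \<open>M\<close>.\<close>

lemma num_gapfree_rec:
  assumes "m \<ge> 2" and "k 0 \<ge> 1" and "N \<ge> 1"
  shows "num_gapfree m k N =
    (\<Sum>M | m * M < N. ((N - m * M + k 0 - 1) choose (k 0 - 1)) * num_gapfree m (\<lambda>j. k (Suc j)) M)"
proof -
  let ?I = "{M. m * M < N}"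
  let ?X = "\<lambda>M. multisets_of_size {1..k 0} (N - m * M)"
  let ?G = "\<lambda>M. {Q. coloured_mary_partition m (\<lambda>j. k (Suc j)) M Q \<and> without_gaps Q}"
  let ?S = "{P. coloured_mary_partition m k N P \<and> without_gaps P}"
  have M_less: "M < N" if "m * M < N" for M
    using that assms(1) by (metis le_less_trans mult.commute mult_le_mono2 nat_mult_1_right one_le_numeral order_trans)
  then have "finite ?I"
    by (auto intro: finite_subset[of _ "{..<N}"])
  have "bij_betw (\<lambda>(M, A, Q). join_units A Q) (SIGMA M:?I. ?X M \<times> ?G M) ?S"
  proof (rule bij_betwI')
    fix x y assume "x \<in> (SIGMA M:?I. ?X M \<times> ?G M)" "y \<in> (SIGMA M:?I. ?X M \<times> ?G M)"
    then show "((case x of (M, A, Q) \<Rightarrow> join_units A Q) = (case y of (M, A, Q) \<Rightarrow> join_units A Q)) \<longleftrightarrow> x = y"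
      by (auto simp: coloured_mary_partition_def)
  next
    fix x assume "x \<in> (SIGMA M:?I. ?X M \<times> ?G M)"
    then obtain M A Q where x: "x = (M, A, Q)" and M: "m * M < N"
      and A: "set_mset A \<subseteq> {1..k 0}" "size A = N - m * M" and Q: "Q \<in> ?G M"
      by (auto simp: multisets_of_size_def)
    have "N = size A + m * M" "A \<noteq> {#}"
      using M A(2) by auto
    then show "(case x of (M, A, Q) \<Rightarrow> join_units A Q) \<in> ?S"
      unfolding x using A(1) Q by (auto simp: coloured_join_units_iff without_gaps_join_units_iff)
  next
    fix P assume P: "P \<in> ?S"
    obtain A Q where PAQ: "P = join_units A Q"
      by (rule join_units_exhaust)
    obtain M where M: "coloured_mary_partition m (\<lambda>j. k (Suc j)) M Q" "N = size A + m * M"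
      and A: "set_mset A \<subseteq> {1..k 0}" and Q: "without_gaps Q" "Q \<noteq> {#} \<longrightarrow> A \<noteq> {#}"
      using P unfolding PAQ by (auto simp: coloured_join_units_iff without_gaps_join_units_iff)
    \<comment> \<open>Without units, the absence of gaps would force \<open>Q\<close> to be empty
      and \<open>N\<close> to be 0.\<close>
    have "A \<noteq> {#}"
      using M Q assms(3) by (auto simp: coloured_mary_partition_def)
    then have "(M, A, Q) \<in> (SIGMA M:?I. ?X M \<times> ?G M)"
      using M A Q by (auto simp: nonempty_has_size multisets_of_size_def)
    then show "\<exists>x \<in> (SIGMA M:?I. ?X M \<times> ?G M). P = (case x of (M, A, Q) \<Rightarrow> join_units A Q)"
      using PAQ by force
  qed
  then have "num_gapfree m k N = card (SIGMA M:?I. ?X M \<times> ?G M)"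
    unfolding num_gapfree_def by (simp add: bij_betw_same_card)
  also have "\<dots> = (\<Sum>M\<in>?I. card (?X M \<times> ?G M))"
  proof (rule card_SigmaI[OF \<open>finite ?I\<close>], intro ballI finite_cartesian_product)
    fix M
    show "finite (?X M)"
      by (intro finite_multisets_of_size) simp
    show "finite (?G M)"
      by (rule finite_subset[OF _ finite_coloured_mary_partitions[OF assms(1)]]) auto
  qed
  also have "\<dots> = (\<Sum>M\<in>?I. ((N - m * M + k 0 - 1) choose (k 0 - 1)) * num_gapfree m (\<lambda>j. k (Suc j)) M)"
  proof (rule sum.cong[OF refl])
    fix M
    have "card (?X M) = (N - m * M + k 0 - 1) choose (N - m * M)"
      by (simp add: card_multisets_of_size add.commute)
    \<comment> \<open>The lower entry must not depend on \<open>M\<close> for periodicity in the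
      upper entry to apply.\<close>
    also have "\<dots> = (N - m * M + k 0 - 1) choose (k 0 - 1)"
      using assms(2) by (subst binomial_symmetric) auto
    finally show "card (?X M \<times> ?G M) =
        ((N - m * M + k 0 - 1) choose (k 0 - 1)) * num_gapfree m (\<lambda>j. k (Suc j)) M"
      by (simp add: card_cartesian_product num_gapfree_def)
  qed
  finally show ?thesis .
qed

section \<open>Congruences for the summatory function\<close>

definition sum_gapfree :: "nat \<Rightarrow> (nat \<Rightarrow> nat) \<Rightarrow> nat \<Rightarrow> int" where
  "sum_gapfree m k n = (\<Sum>N\<le>n. int (num_gapfree m k N))"

text \<open>Summing the recurrence over \<open>N\<close> and swapping the sums leaves diagonal sums
  of binomials. The leading 1 is the term \<open>N = 0\<close>. If \<open>m * M = n\<close>, the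
  coefficient vanishes, so \<open>M = n div m\<close> may always be included.\<close>

lemma sum_gapfree_rec:
  assumes "m \<ge> 2" and "k 0 \<ge> 1"
  shows "sum_gapfree m k n = 1 + (\<Sum>M\<le>n div m.
    (int ((n - m * M + k 0) choose k 0) - 1) * int (num_gapfree m (\<lambda>j. k (Suc j)) M))"
proof -
  let ?f = "\<lambda>a. int ((a + k 0 - 1) choose (k 0 - 1))"
  let ?c = "\<lambda>M. int (num_gapfree m (\<lambda>j. k (Suc j)) M)"
  have le_div: "M \<le> n div m \<longleftrightarrow> m * M \<le> n" for M
    using assms(1) by (simp add: less_eq_div_iff_mult_less_eq mult.commute)
  have "sum_gapfree m k n = int (num_gapfree m k 0) + (\<Sum>N = 1..n. int (num_gapfree m k N))"
    unfolding sum_gapfree_def by (simp add: sum.atMost_shift sum.atLeast1_atMost_eq lessThan_Suc_atMost)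
  also have "(\<Sum>N = 1..n. int (num_gapfree m k N)) =
      (\<Sum>N = 1..n. \<Sum>M | M \<in> {..n div m} \<and> m * M < N. ?f (N - m * M) * ?c M)"
  proof (rule sum.cong[OF refl])
    fix N assume N: "N \<in> {1..n}"
    then have "{M. m * M < N} = {M. M \<in> {..n div m} \<and> m * M < N}"
      by (auto simp: le_div)
    then show "int (num_gapfree m k N) =
        (\<Sum>M | M \<in> {..n div m} \<and> m * M < N. ?f (N - m * M) * ?c M)"
      using N assms by (simp add: num_gapfree_rec)
  qed
  also have "\<dots> = (\<Sum>M\<le>n div m. \<Sum>N | N \<in> {1..n} \<and> m * M < N. ?f (N - m * M) * ?c M)"
    by (rule sum.swap_restrict) auto
  also have "\<dots> = (\<Sum>M\<le>n div m. (int ((n - m * M + k 0) choose k 0) - 1) * ?c M)"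
  proof (rule sum.cong[OF refl])
    fix M assume "M \<in> {..n div m}"
    then have M: "m * M \<le> n"
      by (simp add: le_div)
    have "(\<Sum>N | N \<in> {1..n} \<and> m * M < N. ?f (N - m * M) * ?c M) = (\<Sum>a = 1..n - m * M. ?f a * ?c M)"
      by (rule sum.reindex_bij_witness[of _ "\<lambda>a. a + m * M" "\<lambda>N. N - m * M"]) (use M in auto)
    also have "\<dots> = (int ((n - m * M + k 0) choose k 0) - 1) * ?c M"
      using sum_choose_diagonal[OF assms(2), of "n - m * M"] by (simp flip: sum_distrib_right)
    finally show "(\<Sum>N | N \<in> {1..n} \<and> m * M < N. ?f (N - m * M) * ?c M) =
        (int ((n - m * M + k 0) choose k 0) - 1) * ?c M" .
  qed
  finally show ?thesis
    using assms(1) by simp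
qed

text \<open>As \<open>n - m * M\<close> is congruent to \<open>n\<close>, all coefficients agree
  modulo \<open>m\<close> and factor out. The free choice of the representative \<open>x\<close>
  allows the negative value \<open>- 1\<close>.\<close>

lemma sum_gapfree_cong:
  assumes "m \<ge> 2" and "k 0 \<ge> 1" and "coprime m (fact (k 0))" and "[x = int n] (mod int m)"
  shows "[sum_gapfree m k n =
    1 + (((int (k 0) + x) zchoose k 0) - 1) * sum_gapfree m (\<lambda>j. k (Suc j)) (n div m)] (mod int m)"
proof -
  have binom: "[int ((n - m * M + k 0) choose k 0) = (int (k 0) + x) zchoose k 0] (mod int m)"
    if "M \<in> {..n div m}" for M
  proof -
    have "m * M \<le> n"
      using that assms(1) by (simp add: less_eq_div_iff_mult_less_eq mult.commute)
    then have "int (n - m * M + k 0) = int (k 0) + int n - int m * int M"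
      by (simp add: of_nat_diff)
    moreover have "[int (k 0) + int n - int m * int M = int (k 0) + x - 0] (mod int m)"
      using assms(4) by (intro cong_add cong_diff cong_sym[OF assms(4)]) (auto simp: cong_0_iff)
    ultimately have "[int (n - m * M + k 0) = int (k 0) + x] (mod int m)"
      by (simp only: diff_0_right)
    from zchoose_cong[OF assms(3) this] show ?thesis
      by (simp only: zchoose_of_nat)
  qed
  show ?thesis
    unfolding sum_gapfree_rec[of m k, OF assms(1,2)] sum_gapfree_def[of m "\<lambda>j. k (Suc j)"] sum_distrib_left
    by (intro cong_add cong_sum cong_mult cong_diff cong_refl binom)
qed

text \<open>Unrolling the one-digit step as in Horner's scheme. The last term \<open>i = u\<close>
  stems from the value 1 at argument 0, reached once all digits are used.\<close>

lemma sum_gapfree_digits_cong: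
  assumes "m \<ge> 2" and "\<And>j. k j \<ge> 1" and "\<And>j. coprime m (fact (k j))"
    and "\<And>j. j < u \<Longrightarrow> d j < m"
  shows "[sum_gapfree m k (\<Sum>j<u. d j * m ^ j) =
    (\<Sum>i\<le>u. \<Prod>j<i. ((int (k j) + int (d j)) zchoose k j) - 1)] (mod int m)"
  using assms(2-4)
proof (induction u arbitrary: k d)
  case 0
  then show ?case
    using assms(1) by (simp add: sum_gapfree_def)
next
  case (Suc u)
  let ?n = "\<Sum>j<u. d (Suc j) * m ^ j"
  let ?b = "\<lambda>j. ((int (k j) + int (d j)) zchoose k j) - 1"
  have n: "(\<Sum>j<Suc u. d j * m ^ j) = d 0 + m * ?n"
    by (simp only: sum.lessThan_Suc_shift) (simp add: sum_distrib_left mult.left_commute)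
  have "d 0 < m"
    using Suc.prems(3) by simp
  then have "(d 0 + m * ?n) div m = ?n"
    by simp
  moreover have "[int (d 0) = int (d 0 + m * ?n)] (mod int m)"
    by (simp add: cong_def)
  ultimately have "[sum_gapfree m k (d 0 + m * ?n) =
      1 + ?b 0 * sum_gapfree m (\<lambda>j. k (Suc j)) ?n] (mod int m)"
    using sum_gapfree_cong[of m k "int (d 0)" "d 0 + m * ?n"] assms(1) Suc.prems(1,2) by simp
  also have "[1 + ?b 0 * sum_gapfree m (\<lambda>j. k (Suc j)) ?n =
      1 + ?b 0 * (\<Sum>i\<le>u. \<Prod>j<i. ?b (Suc j))] (mod int m)"
    using Suc.prems by (intro cong_add cong_mult cong_refl Suc.IH) auto
  \<comment> \<open>The summand 1 is the empty product at \<open>i = 0\<close>; all other products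
    contain \<open>?b 0\<close>.\<close>
  also have "1 + ?b 0 * (\<Sum>i\<le>u. \<Prod>j<i. ?b (Suc j)) = (\<Sum>i\<le>Suc u. \<Prod>j<i. ?b j)"
    by (simp only: sum.atMost_Suc_shift prod.lessThan_Suc_shift) (simp add: sum_distrib_left)
  finally show ?case
    unfolding n .
qed

text \<open>Subtracting one turns the lowest digit \<open>0\<close> into \<open>- 1\<close> modulo \<open>m\<close>, which annihilates
  the binomial coefficient.\<close>

lemma sum_gapfree_mult_pred_cong:
  assumes "m \<ge> 2" and "k 0 \<ge> 1" and "coprime m (fact (k 0))" and "n \<ge> 1"
  shows "[sum_gapfree m k (m * n - 1) = 1 - sum_gapfree m (\<lambda>j. k (Suc j)) (n - 1)] (mod int m)"
proof -
  obtain l where l: "n = Suc l"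
    using assms(4) by (cases n) auto
  \<comment> \<open>The borrow makes the lowest digit \<open>m - 1\<close> and leaves the quotient
    \<open>n - 1\<close>.\<close>
  have eq: "m * n - 1 = (m - 1) + m * l"
    using assms(1) by (simp add: l)
  have "((m - 1) + m * l) div m = l + (m - 1) div m"
    using assms(1) by (intro div_mult_self2) simp
  then have "(m * n - 1) div m = n - 1"
    unfolding eq using assms(1) by (simp only: l) simp
  moreover have "[- 1 = int (m * n - 1)] (mod int m)"
    using assms(1,4) by (simp add: of_nat_diff cong_iff_dvd_diff)
  moreover have "(int (k 0) + - 1) zchoose k 0 = 0"
    using zchoose_of_nat[of "k 0 - 1" "k 0"] assms(2) by (simp add: of_nat_diff)
  ultimately show ?thesis
    using sum_gapfree_cong[of m k "- 1" "m * n - 1"] assms(1-3) by simp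
qed

text \<open>Each trailing zero digit applies the map sending \<open>x\<close> to
  \<open>1 - x\<close>; iterating it yields the alternating sign and the parity term.\<close>

lemma sum_gapfree_power_mult_pred_cong:
  assumes "m \<ge> 2" and "\<And>j. k j \<ge> 1" and "\<And>j. coprime m (fact (k j))" and "n \<ge> 1"
  shows "[sum_gapfree m k (m ^ u * n - 1) =
    (if even u then 0 else 1) + (-1) ^ u * sum_gapfree m (\<lambda>j. k (j + u)) (n - 1)] (mod int m)"
  using assms(2,3)
proof (induction u arbitrary: k)
  case (Suc u)
  let ?S = "sum_gapfree m (\<lambda>j. k (j + Suc u)) (n - 1)"
  have "[sum_gapfree m k (m * (m ^ u * n) - 1) =
      1 - sum_gapfree m (\<lambda>j. k (Suc j)) (m ^ u * n - 1)] (mod int m)"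
    using assms(1,4) Suc.prems by (intro sum_gapfree_mult_pred_cong) auto
  also have "[1 - sum_gapfree m (\<lambda>j. k (Suc j)) (m ^ u * n - 1) =
      1 - ((if even u then 0 else 1) + (-1) ^ u * ?S)] (mod int m)"
    using Suc.IH[of "\<lambda>j. k (Suc j)"] Suc.prems by (intro cong_diff cong_refl) simp
  also have "1 - ((if even u then 0 else 1) + (-1) ^ u * ?S) =
      (if even (Suc u) then 0 else 1) + (-1) ^ Suc u * ?S"
    by simp
  finally show ?case
    by (simp add: mult.assoc)
qed simp

section \<open>From partial sums back to the counting function\<close>

text \<open>Since \<open>d < m\<close>, the recurrence runs over all \<open>M \<le> n - 1\<close>
  whatever \<open>d\<close> is, and every upper entry is congruent to \<open>k 0 - 1 - d\<close>.
  The lower entry is \<open>k 0 - 1\<close>, so it is \<open>fact (k 0 - 1)\<close> that must be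
  invertible.\<close>

lemma num_gapfree_cong:
  assumes "m \<ge> 2" and "k 0 \<ge> 1" and "coprime m (fact (k 0 - 1))" and "n \<ge> 1" and "d < m"
  shows "[int (num_gapfree m k (m * n - d)) =
    ((int (k 0) - 1 - int d) zchoose (k 0 - 1)) * sum_gapfree m (\<lambda>j. k (Suc j)) (n - 1)] (mod int m)"
proof -
  have less: "m * M < m * n - d \<longleftrightarrow> M \<le> n - 1" for M
  proof
    assume "m * M < m * n - d"
    then have "m * M < m * n"
      by linarith
    then show "M \<le> n - 1"
      by auto
  next
    assume "M \<le> n - 1"
    then have "m * Suc M \<le> m * n"
      using assms(4) by (intro mult_le_mono2) simp
    with assms(5) show "m * M < m * n - d"
      by simp
  qed
  have "m * 1 \<le> m * n"
    using assms(4) by (intro mult_le_mono2)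
  with assms(5) have d_less: "d < m * n"
    by linarith
  have binom: "[int ((m * n - d - m * M + k 0 - 1) choose (k 0 - 1)) =
      (int (k 0) - 1 - int d) zchoose (k 0 - 1)] (mod int m)" if "M \<in> {..n - 1}" for M
  proof -
    have "m * M < m * n - d"
      using that less by simp
    then have "int (m * n - d - m * M + k 0 - 1) = (int (k 0) - 1 - int d) + int m * (int n - int M)"
      using assms(2) d_less by (simp add: of_nat_diff algebra_simps)
    then have "[int (m * n - d - m * M + k 0 - 1) = int (k 0) - 1 - int d] (mod int m)"
      by (simp add: cong_iff_dvd_diff)
    from zchoose_cong[OF assms(3) this] show ?thesis
      by (simp only: zchoose_of_nat)
  qed
  have "int (num_gapfree m k (m * n - d)) = (\<Sum>M\<le>n - 1.
      int ((m * n - d - m * M + k 0 - 1) choose (k 0 - 1)) * int (num_gapfree m (\<lambda>j. k (Suc j)) M))"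
    using num_gapfree_rec[of m k "m * n - d"] assms(1,2) d_less
    by (simp add: less atMost_def)
  then show ?thesis
    unfolding sum_gapfree_def sum_distrib_left
    by (simp only:) (intro cong_sum cong_mult cong_refl binom)
qed

theorem corollary3p2:
  fixes m n s t d0 :: nat and k d :: "nat \<Rightarrow> nat"
  assumes "m \<ge> 2"
    and "\<And>j. k j \<ge> 1"
    and "n \<ge> 1"
    and "m dvd n"
    and "1 \<le> s" and "s \<le> t"
    and "n = (\<Sum>j = s..t. d j * m ^ j)"
    and "1 \<le> d s" and "d s \<le> m - 1"
    and "\<And>j. s < j \<Longrightarrow> j \<le> t \<Longrightarrow> d j \<le> m - 1"
    and "coprime m (fact (k 0 - 1))"
    and "\<And>j. j \<ge> 1 \<Longrightarrow> coprime m (fact (k j))"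
    and "d0 \<le> m - 1"
  shows "[int (num_gapfree m k (n - d0)) =
      ((int (k 0) - 1 - int d0) zchoose (k 0 - 1)) *
      ((if even s then 0 else 1) +
       (-1) ^ (s - 1) * (((int (k s) + int (d s) - 1) zchoose (k s)) - 1) *
       (\<Sum>i = s..t. \<Prod>j = s + 1..i. (((int (k j) + int (d j)) zchoose (k j)) - 1)))] (mod int m)"
proof -
  \<comment> \<open>Removing the units uses up one factor \<open>m\<close> of \<open>m ^ s\<close>;
    \<open>u\<close> trailing zeros remain.\<close>
  define u where "u = s - 1"
  have s: "s = Suc u"
    using assms(5) by (simp add: u_def)
  define h where "h = (\<Sum>j<t - s. d (j + Suc s) * m ^ j)"
  define b where "b = (\<lambda>j. ((int (k j) + int (d j)) zchoose (k j)) - 1)"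
  \<comment> \<open>After the zeros, 1 is still to be subtracted from \<open>?n\<close>; as
    \<open>d s \<ge> 1\<close>, this lowers its lowest digit to \<open>d s - 1\<close> without a
    borrow.\<close>
  define c where "c = ((int (k s) + int (d s) - 1) zchoose (k s)) - 1"
  define S where "S = (\<Sum>i = s..t. \<Prod>j = s + 1..i. b j)"
  let ?n = "d s + m * h"
  let ?T = "\<lambda>v. sum_gapfree m (\<lambda>j. k (j + v))"
  have "n = (\<Sum>j<Suc (t - s). d (j + s) * m ^ (j + s))"
    unfolding assms(7)
    by (rule sum.reindex_bij_witness[of _ "\<lambda>j. j + s" "\<lambda>j. j - s"]) (use assms(6) in auto)
  also have "\<dots> = m ^ s * ?n"
    unfolding h_def sum.lessThan_Suc_shift
    by (simp add: power_add sum_distrib_left algebra_simps)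
  finally have n: "n = m * (m ^ u * ?n)"
    by (simp add: s mult.assoc)
  have S: "S = (\<Sum>i\<le>t - s. \<Prod>j<i. b (j + Suc s))"
    unfolding S_def
  proof (rule sum.reindex_bij_witness[of _ "\<lambda>i. i + s" "\<lambda>i. i - s"])
    fix i assume "i \<in> {s..t}"
    then show "(\<Prod>j<i - s. b (j + Suc s)) = (\<Prod>j = s + 1..i. b j)"
      by (intro prod.reindex_bij_witness[of _ "\<lambda>j. j - Suc s" "\<lambda>j. j + Suc s"]) auto
  qed (use assms(6) in auto)
  have top: "[?T (Suc s) h = S] (mod int m)"
    unfolding S b_def h_def
  proof (rule sum_gapfree_digits_cong)
    fix j assume "j < t - s"
    then have "d (j + Suc s) \<le> m - 1"
      by (intro assms(10)) auto
    with assms(1) show "d (j + Suc s) < m"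
      by linarith
  qed (use assms(1,2,12) in auto)
  have "?n - 1 = (d s - 1) + m * h"
    using assms(8) by simp
  then have "(?n - 1) div m = h"
    using assms(1,9) by simp
  moreover have "[int (d s) - 1 = int (?n - 1)] (mod int m)"
    using assms(8) by (simp add: of_nat_diff cong_iff_dvd_diff)
  ultimately have "[?T s (?n - 1) = 1 + c * ?T (Suc s) h] (mod int m)"
    using sum_gapfree_cong[of m "\<lambda>j. k (j + s)" "int (d s) - 1" "?n - 1"] assms(1,2,5,12)
    by (simp add: c_def add_diff_eq)
  also have "[1 + c * ?T (Suc s) h = 1 + c * S] (mod int m)"
    by (intro cong_add cong_mult cong_refl top)
  finally have digit: "[?T s (?n - 1) = 1 + c * S] (mod int m)" .
  have "[?T 1 (m ^ u * ?n - 1) =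
      (if even u then 0 else 1) + (-1) ^ u * ?T s (?n - 1)] (mod int m)"
    using sum_gapfree_power_mult_pred_cong[of m "\<lambda>j. k (j + 1)" ?n u] assms(1,2,8,12)
    by (simp add: s)
  also have "[(if even u then 0 else 1) + (-1) ^ u * ?T s (?n - 1) =
      (if even u then 0 else 1) + (-1) ^ u * (1 + c * S)] (mod int m)"
    by (intro cong_add cong_mult cong_refl digit)
  \<comment> \<open>Adding \<open>(-1) ^ u\<close> turns the indicator of odd \<open>u\<close> into
    that of odd \<open>s\<close>, because \<open>s = u + 1\<close>.\<close>
  also have "(if even u then 0 else 1) + (-1) ^ u * (1 + c * S) =
      (if even s then 0 else 1) + (-1) ^ u * c * S"
    by (simp add: s algebra_simps)
  finally have low: "[?T 1 (m ^ u * ?n - 1) =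
      (if even s then 0 else 1) + (-1) ^ u * c * S] (mod int m)" .
  have "[int (num_gapfree m k (n - d0)) =
      ((int (k 0) - 1 - int d0) zchoose (k 0 - 1)) * ?T 1 (m ^ u * ?n - 1)] (mod int m)"
    using num_gapfree_cong[of m k "m ^ u * ?n" d0] assms(1,2,8,11,13)
    by (simp add: n Suc_le_eq)
  also have "[((int (k 0) - 1 - int d0) zchoose (k 0 - 1)) * ?T 1 (m ^ u * ?n - 1) =
      ((int (k 0) - 1 - int d0) zchoose (k 0 - 1)) *
      ((if even s then 0 else 1) + (-1) ^ u * c * S)] (mod int m)"
    by (intro cong_mult cong_refl low)
  finally show ?thesis
    unfolding c_def S_def b_def u_def .
qed

end
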